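(* For all integers $r,s\ge1$ and $N\ge2$, the mean profit per turn $\mu_{[r,s]}^{(N)}$ (defined in the context, depending on the parameter $\rho>0$) is positive if $0<\rho<1$, zero if $\rho=1$, and negative if $\rho>1$.
   Context: The model. There are $N\ge2$ players, each having an integer capital. For a parameter $\rho>0$ put $$p_0:=\frac{\rho^2}{1+\rho^2},\qquad p_1=p_2:=\frac1{1+\rho},\qquad q_j:=1-p_j\quad(j=0,1,2).$$ Game $B$: one of the $N$ players is selected uniformly at random; if his current capital is congruent to $j$ (mod 3), $j\in\{0,1,2\}$, he wins one unit with probability $p_j$ and loses one unit with probability $q_j$. Game $A'$: two distinct players are selected uniformly at random without replacement, and the first transfers one unit of his capital to the second. For integers $r,s\ge1$, the nonrandom pattern $[r,s]$ means that game $A'$ is played $r$ times, then game $B$ is played $s$ times, and this pattern $(A')^rB^s$ of $r+s$ turns is repeated forever. All random choices at different turns are independent given the current capitals. Let $S_n$ be the total change in the sum of all $N$ players' capitals over the first $n$ turns (each play of $B$ contributes $+1$ or $-1$, each play of $A'$ contributes $0$). The mean profit per turn is $$\mu_{[r,s]}^{(N)}:=\lim_{n\to\infty}n^{-1}\mathrm{E}[S_n],$$ which exists and does not depend on the initial capitals. *)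

theory Defs
  imports "HOL-Probability.Probability"
begin

text \<open>The players are \<open>0, \<dots>, N - 1\<close>; a state assigns to each player his integer capital.
  Values at indices \<open>\<ge> N\<close> are never read or changed.\<close>

type_synonym capitals = "nat \<Rightarrow> int"

text \<open>Here \<open>j\<close> is the residue of the capital modulo 3; \<open>mod\<close> on \<open>int\<close> takes values in
  \<open>{0, 1, 2}\<close> also for negative capitals.\<close>

definition win_prob :: "real \<Rightarrow> int \<Rightarrow> real" where
  "win_prob \<rho> j = (if j = 0 then \<rho>\<^sup>2 / (1 + \<rho>\<^sup>2) else 1 / (1 + \<rho>))"

definition game_B :: "real \<Rightarrow> nat \<Rightarrow> capitals \<Rightarrow> capitals pmf" where
  "game_B \<rho> N x =
     do {
       i \<leftarrow> pmf_of_set {..<N};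
       win \<leftarrow> bernoulli_pmf (win_prob \<rho> (x i mod 3));
       return_pmf (x(i := x i + (if win then 1 else - 1)))
     }"

definition game_A' :: "nat \<Rightarrow> capitals \<Rightarrow> capitals pmf" where
  "game_A' N x =
     do {
       i \<leftarrow> pmf_of_set {..<N};
       j \<leftarrow> pmf_of_set ({..<N} - {i});
       return_pmf (x(i := x i - 1, j := x j + 1))
     }"

text \<open>Turns are numbered from \<open>0\<close>, so each block of \<open>r + s\<close> turns consists of \<open>r\<close> plays of
  \<open>A'\<close> followed by \<open>s\<close> plays of \<open>B\<close>.\<close>

definition turn :: "real \<Rightarrow> nat \<Rightarrow> nat \<Rightarrow> nat \<Rightarrow> nat \<Rightarrow> capitals \<Rightarrow> capitals pmf" where
  "turn \<rho> N r s n = (if n mod (r + s) < r then game_A' N else game_B \<rho> N)"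

primrec capitals_after ::
    "real \<Rightarrow> nat \<Rightarrow> nat \<Rightarrow> nat \<Rightarrow> capitals \<Rightarrow> nat \<Rightarrow> capitals pmf" where
  "capitals_after \<rho> N r s x 0 = return_pmf x"
| "capitals_after \<rho> N r s x (Suc n) = capitals_after \<rho> N r s x n \<bind> turn \<rho> N r s n"

text \<open>\<open>E[S\<^sub>n]\<close> for initial capitals \<open>x\<close>. The distributions involved have finite support, so
  integrability is not an issue.\<close>

definition expected_profit ::
    "real \<Rightarrow> nat \<Rightarrow> nat \<Rightarrow> nat \<Rightarrow> capitals \<Rightarrow> nat \<Rightarrow> real" where
  "expected_profit \<rho> N r s x n =
     measure_pmf.expectation (capitals_after \<rho> N r s x n)
       (\<lambda>y. real_of_int ((\<Sum>i<N. y i) - (\<Sum>i<N. x i)))"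

definition mean_profit :: "real \<Rightarrow> nat \<Rightarrow> nat \<Rightarrow> nat \<Rightarrow> real" where
  "mean_profit \<rho> N r s =
     (THE \<mu>. \<forall>x. (\<lambda>n. expected_profit \<rho> N r s x n / real n) \<longlonglongrightarrow> \<mu>)"

end

theory Submission
  imports Defs
begin

text \<open>The capital of a single player modulo 3 is itself a Markov chain, and by linearity the expected
  profit is a sum of functionals of these chains. On functions of period 3, game \<open>A'\<close> acts as
  \<open>a I + (1 - a) U\<close> with \<open>a = 1 - 3 / N\<close> and \<open>U\<close> the average over a period, while \<open>B\<close> acts as
  \<open>I - (I - P) / N\<close>. The drift \<open>2 p\<^sub>j - 1\<close> is a sum of two eigenfunctions of \<open>P\<close>, with
  eigenvalues \<open>-1 < \<kappa>\<^sub>2 < \<kappa>\<^sub>1 < 0\<close> when \<open>\<rho> \<noteq> 1\<close>, so the expectations of these eigenfunctions obey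
  scalar affine recursions, whose long-run averages are explicit. As the drift and its image under
  \<open>P\<close> turn out to have the same average over a period, a positive multiple of \<open>(1 - \<rho>)\<^sup>3\<close>, the mean
  profit is a positive multiple of \<open>(1 - \<rho>)\<^sup>3 (G b\<^sub>1 - G b\<^sub>2)\<close>, where \<open>b\<^sub>i = 1 - (1 - \<kappa>\<^sub>i) / N\<close> and
  \<open>G b = (1 - b\<^sup>s) / ((1 - a\<^sup>r b\<^sup>s) (1 - b)\<^sup>2)\<close> is strictly increasing on \<open>(0, 1)\<close>.\<close>

section \<open>Long-run averages of periodic sequences and affine recursions\<close>

text \<open>Subtracting the linear trend from the partial sums leaves a sequence \<open>g\<close>
  that is again periodic, hence takes finitely many values and is bounded; division by
  \<open>n\<close> makes it vanish.\<close>

lemma periodic_average: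
  fixes f :: "nat \<Rightarrow> real"
  assumes p: "p > 0" and per: "\<And>n. f (n + p) = f n"
  shows "(\<lambda>n. (\<Sum>j<n. f j) / real n) \<longlonglongrightarrow> (\<Sum>j<p. f j) / real p"
proof -
  define g where "g n = (\<Sum>j<n. f j) - real n * ((\<Sum>j<p. f j) / real p)" for n
  have "(\<Sum>j<n+p. f j) = (\<Sum>j<n. f j) + (\<Sum>j<p. f j)" for n
    by (induction n) (simp_all add: per)
  then have gper: "g (n + p) = g n" for n
    using p by (simp add: g_def field_simps)
  have "g (n + k * p) = g n" for n k
  proof (induction k)
    case (Suc k)
    then show ?case using gper[of "n + k * p"] by (simp add: algebra_simps)
  qed simp
  from this[of "n mod p" "n div p" for n] have gmod: "g n = g (n mod p)" for n
    by simp
  have "g n \<in> g ` {..<p}" for n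
    using gmod[of n] p by (metis imageI lessThan_iff mod_less_divisor)
  then have "range g \<subseteq> g ` {..<p}" by blast
  then have "Bseq g"
    by (meson Bseq_eq_bounded finite_imageI finite_imp_bounded finite_lessThan bounded_subset)
  then obtain K where "\<And>n. norm (g n) \<le> K" by (metis BseqE)
  then have "(\<lambda>n. inverse (real n) * g n) \<longlonglongrightarrow> 0"
    using lim_inverse_n by (intro lim_null_mult_right_bounded[where B = K]) auto
  then have "(\<lambda>n. inverse (real n) * g n + (\<Sum>j<p. f j) / real p) \<longlonglongrightarrow> 0 + (\<Sum>j<p. f j) / real p"
    by (intro tendsto_intros)
  moreover have "eventually (\<lambda>n. inverse (real n) * g n + (\<Sum>j<p. f j) / real p = (\<Sum>j<n. f j) / real n) sequentially"
    using eventually_gt_at_top[of 0]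
    by eventually_elim (simp add: g_def field_simps)
  ultimately show ?thesis
    by (simp add: Lim_transform_eventually)
qed

text \<open>The summand is the periodic orbit of the recursion plus a term that decays geometrically.\<close>

lemma periodic_affine_average:
  fixes m :: "nat \<Rightarrow> real"
  assumes a: "\<bar>a\<bar> < 1" and b: "0 < b" "b < 1" and r: "r \<ge> 1" and s: "s \<ge> 1"
    and m: "\<And>n. m (Suc n) = (if n mod (r + s) < r then a * m n + (1 - a) * w else b * m n)"
  shows "(\<lambda>n. (\<Sum>j<n. if j mod (r + s) < r then 0 else m j) / real n) \<longlonglongrightarrow>
    w * ((1 - a ^ r) * (1 - b ^ s) / ((1 - a ^ r * b ^ s) * (1 - b))) / real (r + s)"
proof -
  define p where "p = r + s"
  \<comment> \<open>The fixed point of one full period, that is, the solution of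
    \<open>z = b ^ s * (w + a ^ r * (z - w))\<close>. Started there, the recursion yields the
    periodic orbit \<open>M\<close>.\<close>
  define z where "z = w * b ^ s * (1 - a ^ r) / (1 - a ^ r * b ^ s)"
  define M where "M = rec_nat z (\<lambda>n y. if n mod p < r then a * y + (1 - a) * w else b * y)"
  have M0: "M 0 = z" by (simp add: M_def)
  have MS: "M (Suc n) = (if n mod p < r then a * M n + (1 - a) * w else b * M n)" for n
    by (simp add: M_def)
  have "\<bar>a ^ r\<bar> < 1" "b ^ s < 1" "0 < b ^ s"
    using a b r s by (simp_all add: power_abs power_Suc_less_one power_less_one_iff abs_less_iff)
  then have ab: "a ^ r * b ^ s < 1"
    by (smt (verit) mult_left_le mult_le_0_iff mult_less_cancel_right2)
  have M1: "M j = w + a ^ j * (z - w)" if "j \<le> r" for j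
    using that
  proof (induction j)
    case (Suc j)
    then have "M (Suc j) = a * (w + a ^ j * (z - w)) + (1 - a) * w"
      using s by (simp add: MS p_def)
    then show ?case by (simp add: algebra_simps)
  qed (simp add: M0)
  have M2: "M (r + j) = b ^ j * M r" if "j \<le> s" for j
    using that
  proof (induction j)
    case (Suc j)
    then show ?case using s by (simp add: MS p_def)
  qed simp
  have Mr: "M r = w * (1 - a ^ r) / (1 - a ^ r * b ^ s)"
    using ab by (simp add: M1 z_def field_simps)
  have Mp: "M p = z"
    by (simp add: p_def M2 Mr z_def)
  have Mper: "M (n + p) = M n" for n
    by (induction n) (simp_all add: M0 Mp MS)
  define f where "f j = (if j mod p < r then 0 else M j)" for j
  define d where "d j = m j - M j" for j
  \<comment> \<open>Two orbits of the recursion differ by a factor \<open>a\<close> or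
    \<open>b\<close> per turn, so \<open>c\<close> bounds the contraction whichever game is
    played.\<close>
  define c where "c = max \<bar>a\<bar> b"
  have c: "0 \<le> c" "c < 1" using a b by (auto simp: c_def)
  have d: "\<bar>d j\<bar> \<le> c ^ j * \<bar>d 0\<bar>" for j
  proof (induction j)
    case (Suc j)
    have "d (Suc j) = (if j mod p < r then a else b) * d j"
      by (simp add: d_def m MS p_def algebra_simps)
    then have "\<bar>d (Suc j)\<bar> \<le> c * \<bar>d j\<bar>"
      using b by (auto simp: abs_mult c_def intro!: mult_right_mono)
    also have "\<dots> \<le> c * (c ^ j * \<bar>d 0\<bar>)"
      using Suc c by (intro mult_left_mono)
    finally show ?case by simp
  qed simp
  define e where "e j = (if j mod p < r then 0 else d j)" for j
  have "norm (e j) \<le> c ^ j * \<bar>d 0\<bar>" for j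
    using d[of j] c by (simp add: e_def)
  moreover have "summable (\<lambda>j. c ^ j * \<bar>d 0\<bar>)"
    using c by (intro summable_mult2 summable_geometric) simp
  ultimately have "summable e"
    by (rule summable_comparison_test'[rotated])
  then have "(\<lambda>n. (\<Sum>j<n. e j) * inverse (real n)) \<longlonglongrightarrow> (\<Sum>j. e j) * 0"
    by (intro tendsto_mult lim_inverse_n summable_LIMSEQ)
  moreover have "(\<lambda>n. (\<Sum>j<n. f j) / real n) \<longlonglongrightarrow> (\<Sum>j<p. f j) / real p"
    using r by (intro periodic_average) (simp_all add: f_def Mper p_def[symmetric], simp add: p_def)
  ultimately have "(\<lambda>n. (\<Sum>j<n. f j) / real n + (\<Sum>j<n. e j) * inverse (real n)) \<longlonglongrightarrow>
      (\<Sum>j<p. f j) / real p + (\<Sum>j. e j) * 0"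
    by (intro tendsto_add)
  moreover have "(\<Sum>j<n. f j) / real n + (\<Sum>j<n. e j) * inverse (real n)
      = (\<Sum>j<n. if j mod (r + s) < r then 0 else m j) / real n" for n
    by (simp add: divide_inverse flip: distrib_right sum.distrib)
       (intro disjI2 sum.cong, auto simp: f_def e_def d_def p_def)
  moreover have "(\<Sum>j<p. f j) = w * ((1 - a ^ r) * (1 - b ^ s) / ((1 - a ^ r * b ^ s) * (1 - b)))"
  proof -
    have "(\<Sum>j<r + k. f j) = (\<Sum>j<k. b ^ j) * M r" if "k \<le> s" for k
      using that
    proof (induction k)
      case 0
      then show ?case using s by (auto intro!: sum.neutral simp: f_def p_def)
    next
      case (Suc k)
      then show ?case using M2[of k] by (simp add: f_def p_def algebra_simps)
    qed
    from this[of s] show ?thesis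
      using b by (simp add: p_def Mr sum_gp_strict mult_ac)
  qed
  ultimately show ?thesis by (simp add: p_def)
qed

section \<open>Monotonicity of the rate function\<close>

text \<open>Cancelling one factor \<open>1 - t\<close> leaves the geometric sum \<open>S t\<close>,
  which is nondecreasing, over \<open>(1 - \<alpha> * t ^ s) * (1 - t)\<close>, which is strictly
  decreasing. In the application \<open>\<alpha>\<close> is \<open>a ^ r\<close>; it can be
  negative, since \<open>a = - 1 / 2\<close> for two players.\<close>

lemma rate_factor_strict_mono:
  fixes x y \<alpha> :: real
  assumes y: "0 < y" and xy: "y < x" and x: "x < 1" and \<alpha>: "\<bar>\<alpha>\<bar> < 1" and s: "s \<ge> 1"
  shows "(1 - y ^ s) / ((1 - \<alpha> * y ^ s) * (1 - y)\<^sup>2) < (1 - x ^ s) / ((1 - \<alpha> * x ^ s) * (1 - x)\<^sup>2)"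
proof -
  define S where "S t = (\<Sum>j<s. t ^ j)" for t :: real
  have S: "1 - t ^ s = S t * (1 - t)" for t
    unfolding S_def by (simp add: one_diff_power_eq mult.commute)
  have Spos: "0 < S t" if "0 < t" for t
    unfolding S_def using that s by (intro sum_pos) (auto simp: lessThan_empty_iff)
  have Smono: "S y \<le> S x"
    unfolding S_def using y xy by (intro sum_mono power_mono) auto
  have ps: "0 < t ^ s \<and> t ^ s < 1" if "0 < t" "t < 1" for t :: real
    using that s by (simp add: power_less_one_iff)
  have den: "0 < 1 - \<alpha> * t ^ s" if "0 < t" "t < 1" for t
    using ps[OF that] \<alpha> by (smt (verit) mult_left_le mult_le_0_iff mult_less_cancel_right2)
  \<comment> \<open>The function \<open>t ^ s * (1 - t)\<close> need not be monotone, but its growth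
    is at most that of \<open>t\<close>. For negative \<open>\<alpha>\<close> the decrease of
    \<open>1 - t\<close> therefore outweighs the term
    \<open>- \<alpha> * t ^ s * (1 - t)\<close>.\<close>
  have diff: "x ^ s * (1 - x) - y ^ s * (1 - y) \<le> x - y"
  proof -
    have "x ^ s - y ^ s = (x - y) * (\<Sum>j<s. y ^ (s - Suc j) * x ^ j)"
      by (rule power_diff_sumr2)
    also have "(\<Sum>j<s. y ^ (s - Suc j) * x ^ j) \<le> (\<Sum>j<s. x ^ j)"
      using x y xy by (intro sum_mono mult_left_le_one_le) (auto intro: power_le_one)
    finally have 1: "x ^ s - y ^ s \<le> (x - y) * S x"
      using xy by (simp add: S_def)
    have "x ^ s * (1 - x) - y ^ s * (1 - y) = (x ^ s - y ^ s) * (1 - x) - y ^ s * (x - y)"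
      by (simp add: algebra_simps)
    also have "\<dots> \<le> (x ^ s - y ^ s) * (1 - x)"
      using y xy by simp
    also have "\<dots> \<le> ((x - y) * S x) * (1 - x)"
      using 1 x by (intro mult_right_mono) auto
    also have "\<dots> = (x - y) * (1 - x ^ s)"
      by (simp add: S)
    also have "\<dots> \<le> x - y"
      using xy y x by (simp add: mult_left_le)
    finally show ?thesis .
  qed
  have main: "(1 - \<alpha> * x ^ s) * (1 - x) < (1 - \<alpha> * y ^ s) * (1 - y)"
  proof (cases "\<alpha> \<ge> 0")
    case True
    have "y ^ s \<le> x ^ s" using y xy by (intro power_mono) auto
    then have "1 - \<alpha> * x ^ s \<le> 1 - \<alpha> * y ^ s" using True by (simp add: mult_left_mono)
    then show ?thesis using den[of x] y xy x by (intro mult_le_less_imp_less) auto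
  next
    case False
    have "- \<alpha> * (x ^ s * (1 - x) - y ^ s * (1 - y)) \<le> - \<alpha> * (x - y)"
      using False diff by (intro mult_left_mono) auto
    also have "\<dots> < 1 * (x - y)"
      using \<alpha> xy by (intro mult_strict_right_mono) auto
    finally show ?thesis by (simp add: algebra_simps)
  qed
  have eq: "(1 - t ^ s) / ((1 - \<alpha> * t ^ s) * (1 - t)\<^sup>2) = S t / ((1 - \<alpha> * t ^ s) * (1 - t))"
    if "t < 1" for t
    using that by (simp add: S power2_eq_square)
  have "S y / ((1 - \<alpha> * y ^ s) * (1 - y)) \<le> S x / ((1 - \<alpha> * y ^ s) * (1 - y))"
    using Smono den[of y] x y xy by (intro divide_right_mono) auto
  also have "\<dots> < S x / ((1 - \<alpha> * x ^ s) * (1 - x))"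
    using main Spos[of x] den[of x] den[of y] x y xy by (intro divide_strict_left_mono) auto
  finally show ?thesis using x xy by (simp add: eq)
qed

section \<open>One-step expectations under each game\<close>

text \<open>The operator \<open>P\<close> of game \<open>B\<close> for the selected player. It acts
  on functions of the integer capital rather than of its residue, so that it also applies to
  \<open>real_of_int\<close>, which gives the profit.\<close>

definition game_B_step :: "real \<Rightarrow> (int \<Rightarrow> real) \<Rightarrow> int \<Rightarrow> real" where
  "game_B_step \<rho> f c =
     win_prob \<rho> (c mod 3) * f (c + 1) + (1 - win_prob \<rho> (c mod 3)) * f (c - 1)"

definition drift :: "real \<Rightarrow> int \<Rightarrow> real" where
  "drift \<rho> c = 2 * win_prob \<rho> (c mod 3) - 1"

lemma win_prob_bounds:
  assumes "\<rho> > 0"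
  shows "0 \<le> win_prob \<rho> j" "win_prob \<rho> j \<le> 1"
proof -
  have "1 + \<rho>\<^sup>2 > 0" by (simp add: add_pos_nonneg)
  then show "0 \<le> win_prob \<rho> j" "win_prob \<rho> j \<le> 1"
    using assms by (simp_all add: win_prob_def divide_le_eq)
qed

lemma finite_set_game_B: "N \<ge> 1 \<Longrightarrow> finite (set_pmf (game_B \<rho> N x))"
  by (simp add: game_B_def lessThan_empty_iff)

text \<open>Guarantees that a second player is available, so that
  \<open>pmf_of_set ({..<N} - {i})\<close> is taken over a nonempty set.\<close>

lemma lessThan_not_subset_singleton: "(N::nat) \<ge> 2 \<Longrightarrow> \<not> {..<N} \<subseteq> {i}"
  using card_mono[of "{i}" "{..<N}"] by auto

lemma finite_set_game_A': "N \<ge> 2 \<Longrightarrow> finite (set_pmf (game_A' N x))"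
  by (simp add: game_A'_def lessThan_empty_iff lessThan_not_subset_singleton)

lemma expectation_game_B:
  fixes f :: "int \<Rightarrow> real"
  assumes \<rho>: "\<rho> > 0" and N: "N \<ge> 1" and i: "i < N"
  shows "measure_pmf.expectation (game_B \<rho> N x) (\<lambda>y. f (y i)) =
    f (x i) + (game_B_step \<rho> f (x i) - f (x i)) / real N"
proof -
  let ?q = "\<lambda>k. bernoulli_pmf (win_prob \<rho> (x k mod 3)) \<bind>
    (\<lambda>win. return_pmf (x(k := x k + (if win then 1 else - 1))))"
  have q: "measure_pmf.expectation (?q k) (\<lambda>y. f (y i)) =
      f (x i) + (if k = i then game_B_step \<rho> f (x i) - f (x i) else 0)" for k
  proof -
    have "measure_pmf.expectation (?q k) (\<lambda>y. f (y i)) =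
      (\<Sum>win\<in>UNIV. pmf (bernoulli_pmf (win_prob \<rho> (x k mod 3))) win *
         f ((x(k := x k + (if win then 1 else - 1))) i))"
      by (subst pmf_expectation_bind[where A = UNIV]) auto
    then show ?thesis
      using win_prob_bounds[OF \<rho>] by (auto simp: UNIV_bool game_B_step_def algebra_simps)
  qed
  have "measure_pmf.expectation (game_B \<rho> N x) (\<lambda>y. f (y i)) =
      (\<Sum>k<N. measure_pmf.expectation (?q k) (\<lambda>y. f (y i)) / real N)"
    unfolding game_B_def using N
    by (subst pmf_expectation_bind_pmf_of_set) (auto simp: lessThan_empty_iff divide_inverse mult.commute)
  also have "\<dots> = (\<Sum>k<N. f (x i) / real N + (if k = i then (game_B_step \<rho> f (x i) - f (x i)) / real N else 0))"
    unfolding q by (intro sum.cong) (auto simp: add_divide_distrib)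
  also have "\<dots> = f (x i) + (game_B_step \<rho> f (x i) - f (x i)) / real N"
    using N i by (simp add: sum.distrib)
  finally show ?thesis .
qed

text \<open>Player \<open>i\<close> gives with probability \<open>1 / N\<close> and, by symmetry,
  receives with probability \<open>1 / N\<close>; otherwise his capital is unchanged. The proof
  conditions on the giver \<open>k\<close>.\<close>

lemma expectation_game_A':
  fixes f :: "int \<Rightarrow> real"
  assumes N: "N \<ge> 2" and i: "i < N"
  shows "measure_pmf.expectation (game_A' N x) (\<lambda>y. f (y i)) =
    f (x i) + (f (x i + 1) + f (x i - 1) - 2 * f (x i)) / real N"
proof -
  let ?q = "\<lambda>k. pmf_of_set ({..<N} - {k}) \<bind>
    (\<lambda>j. return_pmf (x(k := x k - 1, j := x j + 1)))"
  have q: "measure_pmf.expectation (?q k) (\<lambda>y. f (y i)) =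
      (if k = i then f (x i - 1) else f (x i) + (f (x i + 1) - f (x i)) / (real N - 1))"
    if k: "k < N" for k
  proof -
    have card: "real (card ({..<N} - {k})) = real N - 1"
      using N k by (simp add: card_Diff_singleton_if)
    have "measure_pmf.expectation (?q k) (\<lambda>y. f (y i)) =
      (\<Sum>j\<in>{..<N} - {k}. f ((x(k := x k - 1, j := x j + 1)) i) / (real N - 1))"
      using N by (subst pmf_expectation_bind_pmf_of_set)
        (auto simp: lessThan_not_subset_singleton card divide_inverse sum_distrib_left mult.commute simp del: card_Diff_insert)
    also have "\<dots> = (\<Sum>j\<in>{..<N} - {k}. (if k = i then f (x i - 1) else f (x i)) / (real N - 1) +
        (if j = i then (f (x i + 1) - f (x i)) / (real N - 1) else 0))"
      by (intro sum.cong) (auto simp: diff_divide_distrib)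
    also have "\<dots> = (if k = i then f (x i - 1) else f (x i) + (f (x i + 1) - f (x i)) / (real N - 1))"
      using N i k unfolding sum.distrib by (auto simp: card simp del: card_Diff_insert)
    finally show ?thesis .
  qed
  have "measure_pmf.expectation (game_A' N x) (\<lambda>y. f (y i)) =
      (\<Sum>k<N. measure_pmf.expectation (?q k) (\<lambda>y. f (y i)) / real N)"
    unfolding game_A'_def using N
    by (subst pmf_expectation_bind_pmf_of_set)
       (auto simp: lessThan_empty_iff divide_inverse mult.commute lessThan_not_subset_singleton)
  also have "\<dots> = (\<Sum>k<N. (f (x i) + (f (x i + 1) - f (x i)) / (real N - 1)) / real N +
      (if k = i then (f (x i - 1) - (f (x i) + (f (x i + 1) - f (x i)) / (real N - 1))) / real N else 0))"
    by (intro sum.cong) (auto simp: q diff_divide_distrib)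
  also have "\<dots> = f (x i) + (f (x i + 1) + f (x i - 1) - 2 * f (x i)) / real N"
  proof -
    \<comment> \<open>Naming the quotient removes the denominator \<open>real N - 1\<close>, which
      cancels against the number of givers other than \<open>i\<close>.\<close>
    define t where "t = (f (x i + 1) - f (x i)) / (real N - 1)"
    have "f (x i + 1) = f (x i) + t * (real N - 1)"
      using N by (simp add: t_def)
    then show ?thesis
      using N i unfolding t_def[symmetric] by (simp add: sum.distrib) (simp add: field_simps)
  qed
  finally show ?thesis .
qed

section \<open>Expectations along the pattern of turns\<close>

lemma finite_set_turn: "N \<ge> 2 \<Longrightarrow> finite (set_pmf (turn \<rho> N r s n x))"
  by (simp add: turn_def finite_set_game_A' finite_set_game_B)

lemma finite_set_capitals_after: "N \<ge> 2 \<Longrightarrow> finite (set_pmf (capitals_after \<rho> N r s x n))"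
  by (induction n) (auto simp: finite_set_turn)

lemma expectation_capitals_after_Suc:
  fixes F :: "capitals \<Rightarrow> real"
  assumes N: "N \<ge> 2"
  shows "measure_pmf.expectation (capitals_after \<rho> N r s x (Suc n)) F =
    measure_pmf.expectation (capitals_after \<rho> N r s x n)
      (\<lambda>y. measure_pmf.expectation (turn \<rho> N r s n y) F)"
  by (simp add: pmf_expectation_bind[OF finite_set_capitals_after[OF N] finite_set_turn[OF N] order_refl]
      integral_measure_pmf[OF finite_set_capitals_after[OF N]])

text \<open>Three consecutive integers meet every residue once. This links the translation-invariant
  form of a period sum, which suits the neighbours occurring in \<open>game_A'\<close>, to the
  concrete sum that can be computed.\<close>

lemma three_consecutive:
  fixes v :: "int \<Rightarrow> real"
  assumes "\<And>c. v (c mod 3) = v c"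
  shows "v (c - 1) + v c + v (c + 1) = v 0 + v 1 + v 2"
proof -
  consider "c mod 3 = 0" | "c mod 3 = 1" | "c mod 3 = 2" by linarith
  then show ?thesis
  proof cases
    case 1
    then have "(c - 1) mod 3 = 2" "(c + 1) mod 3 = 1" by presburger+
    then show ?thesis using assms[of c] assms[of "c - 1"] assms[of "c + 1"] 1 by simp
  next
    case 2
    then have "(c - 1) mod 3 = 0" "(c + 1) mod 3 = 2" by presburger+
    then show ?thesis using assms[of c] assms[of "c - 1"] assms[of "c + 1"] 2 by simp
  next
    case 3
    then have "(c - 1) mod 3 = 1" "(c + 1) mod 3 = 0" by presburger+
    then show ?thesis using assms[of c] assms[of "c - 1"] assms[of "c + 1"] 3 by simp
  qed
qed

text \<open>Provides the recursion required by \<open>periodic_affine_average\<close>: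
  \<open>mean\<close> replaces the two neighbours in \<open>expectation_game_A'\<close> by
  \<open>3 * w - v\<close>, and \<open>eigen\<close> turns \<open>game_B\<close> into multiplication
  by a scalar.\<close>

lemma expectation_eigenfunction_Suc:
  fixes v :: "int \<Rightarrow> real"
  assumes \<rho>: "\<rho> > 0" and N: "N \<ge> 2" and i: "i < N"
    and mean: "\<And>c. v (c - 1) + v c + v (c + 1) = 3 * w"
    and eigen: "\<And>c. game_B_step \<rho> v c = \<kappa> * v c"
  shows "measure_pmf.expectation (capitals_after \<rho> N r s x (Suc n)) (\<lambda>y. v (y i)) =
    (if n mod (r + s) < r
     then (1 - 3 / real N) * measure_pmf.expectation (capitals_after \<rho> N r s x n) (\<lambda>y. v (y i)) +
       (1 - (1 - 3 / real N)) * w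
     else (1 - (1 - \<kappa>) / real N) * measure_pmf.expectation (capitals_after \<rho> N r s x n) (\<lambda>y. v (y i)))"
proof -
  note int = integrable_measure_pmf_finite[OF finite_set_capitals_after[OF N]]
  have "measure_pmf.expectation (turn \<rho> N r s n y) (\<lambda>y. v (y i)) =
    (if n mod (r + s) < r then (1 - 3 / real N) * v (y i) + (1 - (1 - 3 / real N)) * w
     else (1 - (1 - \<kappa>) / real N) * v (y i))" for y
  proof (cases "n mod (r + s) < r")
    case True
    have "v (y i + 1) + v (y i - 1) = 3 * w - v (y i)" using mean[of "y i"] by simp
    then have "measure_pmf.expectation (game_A' N y) (\<lambda>y. v (y i)) =
        (1 - 3 / real N) * v (y i) + (1 - (1 - 3 / real N)) * w"
      using N by (simp add: expectation_game_A'[OF N i] field_simps)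
    with True show ?thesis by (simp add: turn_def)
  next
    case False
    have "measure_pmf.expectation (game_B \<rho> N y) (\<lambda>y. v (y i)) = (1 - (1 - \<kappa>) / real N) * v (y i)"
      using N by (simp add: expectation_game_B[OF \<rho> _ i] eigen field_simps)
    with False show ?thesis by (simp add: turn_def)
  qed
  then show ?thesis
    by (simp add: expectation_capitals_after_Suc[OF N] int del: capitals_after.simps)
qed

text \<open>Apply the one-step formulas to \<open>real_of_int\<close>: its second difference
  vanishes, so \<open>A'\<close> keeps each expected capital fixed, while \<open>B\<close> adds the
  drift divided by \<open>N\<close>.\<close>

lemma expected_profit_eq_sum:
  assumes \<rho>: "\<rho> > 0" and N: "N \<ge> 2"
  shows "expected_profit \<rho> N r s x n = (\<Sum>j<n. if j mod (r + s) < r then 0 else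
    (\<Sum>i<N. measure_pmf.expectation (capitals_after \<rho> N r s x j) (\<lambda>y. drift \<rho> (y i))) / real N)"
proof (induction n)
  case 0
  then show ?case by (simp add: expected_profit_def)
next
  case (Suc n)
  note int = integrable_measure_pmf_finite[OF finite_set_capitals_after[OF N]]
    and intt = integrable_measure_pmf_finite[OF finite_set_turn[OF N]]
  have prof: "expected_profit \<rho> N r s x k =
      (\<Sum>i<N. measure_pmf.expectation (capitals_after \<rho> N r s x k) (\<lambda>y. real_of_int (y i)))
        - (\<Sum>i<N. real_of_int (x i))" for k
    by (simp add: expected_profit_def int)
  have "measure_pmf.expectation (turn \<rho> N r s n y) (\<lambda>y. real_of_int (y i)) =
      real_of_int (y i) + (if n mod (r + s) < r then 0 else drift \<rho> (y i) / real N)"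
    if "i < N" for i y
    using N expectation_game_A'[OF N that, of y real_of_int]
      expectation_game_B[OF \<rho> _ that, of y real_of_int]
    by (simp add: turn_def game_B_step_def drift_def algebra_simps)
  then have "measure_pmf.expectation (capitals_after \<rho> N r s x (Suc n)) (\<lambda>y. real_of_int (y i)) =
      measure_pmf.expectation (capitals_after \<rho> N r s x n) (\<lambda>y. real_of_int (y i)) +
      (if n mod (r + s) < r then 0 else
        measure_pmf.expectation (capitals_after \<rho> N r s x n) (\<lambda>y. drift \<rho> (y i)) / real N)"
    if "i < N" for i
    using that by (simp add: expectation_capitals_after_Suc[OF N] int del: capitals_after.simps)
  then show ?case
    using Suc by (simp add: prof sum.distrib sum_divide_distrib del: capitals_after.simps)
qed

section \<open>Spectral analysis of game B on residues modulo 3\<close>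

lemma game_B_step_mod:
  assumes "\<And>c. f (c mod 3) = f c"
  shows "game_B_step \<rho> f (c mod 3) = game_B_step \<rho> f c"
proof -
  have "f (c mod 3 + 1) = f (c + 1)" "f (c mod 3 - 1) = f (c - 1)"
    by (metis assms mod_add_left_eq, metis assms mod_diff_left_eq)
  then show ?thesis by (simp add: game_B_step_def)
qed

lemma drift_mod: "drift \<rho> (c mod 3) = drift \<rho> c"
  by (simp add: drift_def)

text \<open>This is the fairness of \<open>B\<close>: around the cycle of residues the product of
  the win probabilities equals that of the loss probabilities,
  \<open>(1 - q) * p^2 = q * (1 - p)^2\<close>. In this polynomial form it lets
  \<open>algebra\<close> close the identities in \<open>drift_char\<close>.\<close>

lemma win_prob_relation:
  assumes \<rho>: "\<rho> > 0"
  defines "q \<equiv> 1 - win_prob \<rho> 0" and "p \<equiv> win_prob \<rho> 1"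
  shows "q * (p\<^sup>2 + (1 - p)\<^sup>2) = p\<^sup>2"
proof -
  have nz: "1 + \<rho>\<^sup>2 \<noteq> 0" "1 + \<rho> \<noteq> 0" using \<rho> by (auto simp: add_nonneg_eq_0_iff)
  have "q = 1 / (1 + \<rho>\<^sup>2)" "1 - p = \<rho> / (1 + \<rho>)" "p = 1 / (1 + \<rho>)"
    using nz by (simp_all add: q_def p_def win_prob_def field_simps)
  then show ?thesis using nz by (simp add: power_divide flip: add_divide_distrib)
qed

lemma win_prob_2: "win_prob \<rho> 2 = win_prob \<rho> 1"
  by (simp add: win_prob_def)

lemma game_B_step_drift_mod: "game_B_step \<rho> (drift \<rho>) (c mod 3) = game_B_step \<rho> (drift \<rho>) c"
  by (rule game_B_step_mod) (rule drift_mod)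

text \<open>By the Cayley--Hamilton theorem: the transition matrix of game \<open>B\<close> on residues has
  trace \<open>0\<close> and eigenvalue \<open>1\<close>, and because \<open>B\<close> is fair the drift has no component along
  the constants.\<close>

lemma drift_char:
  assumes \<rho>: "\<rho> > 0"
  shows "game_B_step \<rho> (game_B_step \<rho> (drift \<rho>)) c + game_B_step \<rho> (drift \<rho>) c +
    2 * \<rho>\<^sup>2 / ((1 + \<rho>\<^sup>2) * (1 + \<rho>)\<^sup>2) * drift \<rho> c = 0"
proof -
  define q p where "q = 1 - win_prob \<rho> 0" and "p = win_prob \<rho> 1"
  have rel: "q * (p\<^sup>2 + (1 - p)\<^sup>2) = p\<^sup>2"
    using win_prob_relation[OF \<rho>] by (simp add: q_def p_def)
  have w: "win_prob \<rho> 0 = 1 - q" "win_prob \<rho> 1 = p" "win_prob \<rho> 2 = p"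
    by (simp_all add: q_def p_def win_prob_2)
  have nz: "1 + \<rho>\<^sup>2 \<noteq> 0" "1 + \<rho> \<noteq> 0" using \<rho> by (auto simp: add_nonneg_eq_0_iff)
  have "q = 1 / (1 + \<rho>\<^sup>2)" "1 - p = \<rho> / (1 + \<rho>)"
    using nz by (simp_all add: q_def p_def win_prob_def field_simps)
  \<comment> \<open>The determinant of the transition matrix is
    \<open>(1 - q) * p^2 + q * (1 - p)^2\<close>, whose two terms agree by fairness. It is the
    product of the two eigenvalues other than 1.\<close>
  then have \<delta>: "2 * \<rho>\<^sup>2 / ((1 + \<rho>\<^sup>2) * (1 + \<rho>)\<^sup>2) = 2 * q * (1 - p)\<^sup>2"
    by (simp add: power_divide)
  \<comment> \<open>The points 3 and -1 enter as the neighbours of 2 and 0.\<close>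
  have h: "drift \<rho> 0 = 1 - 2 * q" "drift \<rho> 1 = 2 * p - 1" "drift \<rho> 2 = 2 * p - 1"
    "drift \<rho> 3 = 1 - 2 * q" "drift \<rho> (-1) = 2 * p - 1"
    by (simp_all add: drift_def w)
  define g where "g = game_B_step \<rho> (drift \<rho>)"
  have g: "g 0 = 2 * p - 1" "g 1 = p * (2 * p - 1) + (1 - p) * (1 - 2 * q)"
    "g 2 = p * (1 - 2 * q) + (1 - p) * (2 * p - 1)"
    by (simp_all add: g_def game_B_step_def w h algebra_simps)
  have g_ext: "g 3 = g 0" "g (-1) = g 2"
    using game_B_step_drift_mod[of \<rho> 3] game_B_step_drift_mod[of \<rho> "-1"] by (simp_all add: g_def)
  have *: "game_B_step \<rho> g j + g j + 2 * q * (1 - p)\<^sup>2 * drift \<rho> j = 0" if "j \<in> {0, 1, 2}" for j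
  proof -
    have "game_B_step \<rho> g 0 + g 0 + 2 * q * (1 - p)\<^sup>2 * drift \<rho> 0 = 0"
      unfolding game_B_step_def using rel by (simp add: w h g g_ext) algebra
    moreover have "game_B_step \<rho> g 1 + g 1 + 2 * q * (1 - p)\<^sup>2 * drift \<rho> 1 = 0"
      unfolding game_B_step_def using rel by (simp add: w h g g_ext) algebra
    moreover have "game_B_step \<rho> g 2 + g 2 + 2 * q * (1 - p)\<^sup>2 * drift \<rho> 2 = 0"
      unfolding game_B_step_def using rel by (simp add: w h g g_ext) algebra
    ultimately show ?thesis using that by auto
  qed
  have "c mod 3 \<in> {0, 1, 2}"
    by auto
  moreover have "g (j mod 3) = g j" for j
    by (simp add: g_def game_B_step_drift_mod)
  moreover from this have "game_B_step \<rho> g (c mod 3) = game_B_step \<rho> g c"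
    by (rule game_B_step_mod)
  ultimately show ?thesis
    using *[of "c mod 3"] by (simp only: \<delta> drift_mod flip: g_def)
qed

definition drift_mean where "drift_mean \<rho> = (1 - \<rho>) ^ 3 / (3 * ((1 + \<rho>) * (1 + \<rho>\<^sup>2)))" for \<rho> :: real

lemma drift_mean:
  assumes \<rho>: "\<rho> > 0"
  shows "drift \<rho> (c - 1) + drift \<rho> c + drift \<rho> (c + 1) = 3 * drift_mean \<rho>"
proof -
  have nz: "1 + \<rho>\<^sup>2 \<noteq> 0" "1 + \<rho> \<noteq> 0" using \<rho> by (auto simp: add_nonneg_eq_0_iff)
  have "drift \<rho> 0 + drift \<rho> 1 + drift \<rho> 2 = 2 * (\<rho>\<^sup>2 / (1 + \<rho>\<^sup>2)) + 4 * (1 / (1 + \<rho>)) - 3"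
    by (simp add: drift_def win_prob_def)
  also have "\<dots> = (2 * \<rho>\<^sup>2 * (1 + \<rho>) + 4 * (1 + \<rho>\<^sup>2) - 3 * ((1 + \<rho>) * (1 + \<rho>\<^sup>2))) / ((1 + \<rho>) * (1 + \<rho>\<^sup>2))"
    using nz by (simp add: divide_simps)
  also have "2 * \<rho>\<^sup>2 * (1 + \<rho>) + 4 * (1 + \<rho>\<^sup>2) - 3 * ((1 + \<rho>) * (1 + \<rho>\<^sup>2)) = (1 - \<rho>) ^ 3"
    by (simp add: power2_eq_square power3_eq_cube algebra_simps)
  finally show ?thesis
    unfolding three_consecutive[of "drift \<rho>", OF drift_mod] drift_mean_def by simp
qed

text \<open>Since \<open>p_1 = p_2\<close>, the transition probabilities into residue 0 sum to 1, so
  those into residues 1 and 2 sum to 2 jointly. The drift is the same at 1 and 2, so its sum over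
  the residues is preserved.\<close>

lemma game_B_step_drift_mean:
  assumes \<rho>: "\<rho> > 0"
  defines "g \<equiv> game_B_step \<rho> (drift \<rho>)"
  shows "g (c - 1) + g c + g (c + 1) = 3 * drift_mean \<rho>"
proof -
  define q p where "q = 1 - win_prob \<rho> 0" and "p = win_prob \<rho> 1"
  have w: "win_prob \<rho> 0 = 1 - q" "win_prob \<rho> 1 = p" "win_prob \<rho> 2 = p"
    by (simp_all add: q_def p_def win_prob_2)
  have "g 0 + g 1 + g 2 = drift \<rho> 0 + drift \<rho> 1 + drift \<rho> 2"
    by (simp add: g_def game_B_step_def drift_def w algebra_simps)
  then show ?thesis
    using drift_mean[OF \<rho>, of 0] three_consecutive[of g c] three_consecutive[of "drift \<rho>", OF drift_mod, of 0]
    unfolding g_def by (simp add: game_B_step_drift_mod)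
qed

lemma game_B_step_linear:
  "game_B_step \<rho> (\<lambda>c. a * f c + b * g c) c = a * game_B_step \<rho> f c + b * game_B_step \<rho> g c"
  by (simp add: game_B_step_def algebra_simps)

text \<open>By \<open>drift_char\<close> the span of the drift \<open>h\<close> and its image
  \<open>g\<close> is invariant, and the eigenvalues are the roots of
  \<open>t^2 + t + \<delta>\<close>. The period averages of the eigenfunctions follow by linearity,
  as \<open>g\<close> and \<open>h\<close> have the same average.\<close>

lemma drift_eigen_decomposition:
  assumes \<rho>: "\<rho> > 0" "\<rho> \<noteq> 1"
  obtains \<kappa>\<^sub>1 \<kappa>\<^sub>2 v\<^sub>1 v\<^sub>2 where "-1 < \<kappa>\<^sub>2" "\<kappa>\<^sub>2 < \<kappa>\<^sub>1" "\<kappa>\<^sub>1 < 0"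
    and "\<And>c. drift \<rho> c = v\<^sub>1 c + v\<^sub>2 c"
    and "\<And>c. game_B_step \<rho> v\<^sub>1 c = \<kappa>\<^sub>1 * v\<^sub>1 c" "\<And>c. game_B_step \<rho> v\<^sub>2 c = \<kappa>\<^sub>2 * v\<^sub>2 c"
    and "\<And>c. v\<^sub>1 (c - 1) + v\<^sub>1 c + v\<^sub>1 (c + 1) = 3 * (drift_mean \<rho> * (1 - \<kappa>\<^sub>2) / (\<kappa>\<^sub>1 - \<kappa>\<^sub>2))"
    and "\<And>c. v\<^sub>2 (c - 1) + v\<^sub>2 c + v\<^sub>2 (c + 1) = 3 * (drift_mean \<rho> * (\<kappa>\<^sub>1 - 1) / (\<kappa>\<^sub>1 - \<kappa>\<^sub>2))"
proof -
  define \<delta> where "\<delta> = 2 * \<rho>\<^sup>2 / ((1 + \<rho>\<^sup>2) * (1 + \<rho>)\<^sup>2)"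
  have "0 < 1 + \<rho>\<^sup>2" by (simp add: add_pos_nonneg)
  then have den: "0 < (1 + \<rho>\<^sup>2) * (1 + \<rho>)\<^sup>2" using \<rho> by simp
  then have "0 < \<delta>" using \<rho> by (simp add: \<delta>_def)
  \<comment> \<open>This factorisation makes the discriminant \<open>1 - 4 * \<delta>\<close>
    positive for \<open>\<rho>\<close> other than 1, so the roots are real and distinct.\<close>
  have "(1 + \<rho>\<^sup>2) * (1 + \<rho>)\<^sup>2 - 8 * \<rho>\<^sup>2 = (1 - \<rho>)\<^sup>2 * ((1 + \<rho>)\<^sup>2 + 2 * \<rho>)"
    by (simp add: power2_eq_square algebra_simps)
  moreover have "0 < (1 - \<rho>)\<^sup>2 * ((1 + \<rho>)\<^sup>2 + 2 * \<rho>)"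
    using \<rho> by (intro mult_pos_pos add_nonneg_pos) auto
  ultimately have "4 * \<delta> < 1"
    using den by (simp add: \<delta>_def divide_less_eq)
  define D where "D = sqrt (1 - 4 * \<delta>)"
  have D: "0 < D" "D < 1" "D\<^sup>2 = 1 - 4 * \<delta>"
    using \<open>0 < \<delta>\<close> \<open>4 * \<delta> < 1\<close> by (simp_all add: D_def)
  define k1 k2 where "k1 = (D - 1) / 2" and "k2 = (- D - 1) / 2"
  define h g where "h = drift \<rho>" and "g = game_B_step \<rho> h"
  \<comment> \<open>The spectral projections of \<open>h\<close>:
    \<open>(P - k2) h / (k1 - k2)\<close> and \<open>(k1 - P) h / (k1 - k2)\<close>, where
    \<open>D = k1 - k2\<close>.\<close>
  define v1 v2 where "v1 c = 1 / D * g c + - k2 / D * h c"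
    and "v2 c = - 1 / D * g c + k1 / D * h c" for c
  have k: "k1 - k2 = D" "k1 + k2 = - 1" "k1 * k2 = \<delta>"
    using D by (simp_all add: k1_def k2_def field_simps power2_eq_square)
  have gg: "game_B_step \<rho> g c = (k1 + k2) * g c - k1 * k2 * h c" for c
    using drift_char[OF \<rho>(1), of c] unfolding g_def h_def k(2,3) \<delta>_def by simp
  have gh: "game_B_step \<rho> h c = g c" for c
    by (simp add: g_def)
  have mean: "h (c - 1) + h c + h (c + 1) = 3 * drift_mean \<rho>"
    "g (c - 1) + g c + g (c + 1) = 3 * drift_mean \<rho>" for c
    using drift_mean[OF \<rho>(1)] game_B_step_drift_mean[OF \<rho>(1)] by (simp_all add: g_def h_def)
  show ?thesis
  proof
    show "-1 < k2" "k2 < k1" "k1 < 0" using D by (simp_all add: k1_def k2_def)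
    show "drift \<rho> c = v1 c + v2 c" for c
    proof -
      have "v1 c + v2 c = (k1 - k2) / D * h c" by (simp add: v1_def v2_def algebra_simps diff_divide_distrib)
      then show ?thesis using D by (simp add: k h_def)
    qed
    show "game_B_step \<rho> v1 c = k1 * v1 c" for c
      unfolding v1_def game_B_step_linear gg gh using D by (simp add: field_simps)
    show "game_B_step \<rho> v2 c = k2 * v2 c" for c
      unfolding v2_def game_B_step_linear gg gh using D by (simp add: field_simps)
    show "v1 (c - 1) + v1 c + v1 (c + 1) = 3 * (drift_mean \<rho> * (1 - k2) / (k1 - k2))" for c
    proof -
      have "v1 (c - 1) + v1 c + v1 (c + 1) =
        ((g (c - 1) + g c + g (c + 1)) - k2 * (h (c - 1) + h c + h (c + 1))) / D"
        using D by (simp add: v1_def field_simps)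
      then show ?thesis unfolding mean k by (simp add: algebra_simps)
    qed
    show "v2 (c - 1) + v2 c + v2 (c + 1) = 3 * (drift_mean \<rho> * (k1 - 1) / (k1 - k2))" for c
    proof -
      have "v2 (c - 1) + v2 c + v2 (c + 1) =
        (k1 * (h (c - 1) + h c + h (c + 1)) - (g (c - 1) + g c + g (c + 1))) / D"
        using D by (simp add: v2_def field_simps)
      then show ?thesis unfolding mean k by (simp add: algebra_simps)
    qed
  qed
qed

section \<open>Limit of the mean profit and its sign\<close>

lemma eigenfunction_average:
  fixes v :: "int \<Rightarrow> real"
  assumes \<rho>: "\<rho> > 0" and N: "N \<ge> 2" and i: "i < N" and rs: "r \<ge> 1" "s \<ge> 1"
    and mean: "\<And>c. v (c - 1) + v c + v (c + 1) = 3 * w"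
    and eigen: "\<And>c. game_B_step \<rho> v c = \<kappa> * v c"
    and \<kappa>: "-1 < \<kappa>" "\<kappa> < 0"
  defines "a \<equiv> 1 - 3 / real N" and "b \<equiv> 1 - (1 - \<kappa>) / real N"
  shows "(\<lambda>n. (\<Sum>j<n. if j mod (r + s) < r then 0 else
      measure_pmf.expectation (capitals_after \<rho> N r s x j) (\<lambda>y. v (y i))) / real n) \<longlonglongrightarrow>
    w * ((1 - a ^ r) * (1 - b ^ s) / ((1 - a ^ r * b ^ s) * (1 - b))) / real (r + s)"
proof (rule periodic_affine_average)
  \<comment> \<open>As \<open>1 - \<kappa>\<close> lies strictly between 1 and 2, \<open>b\<close>
    is positive already for \<open>N = 2\<close>.\<close>
  show "\<bar>a\<bar> < 1" "0 < b" "b < 1"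
    using N \<kappa> by (auto simp: a_def b_def abs_less_iff divide_simps)
qed (use rs in \<open>simp_all only: a_def b_def expectation_eigenfunction_Suc[OF \<rho> N i mean eigen]\<close>)

text \<open>The weights of the two eigenfunctions have opposite signs. Factoring out
  \<open>(1 - k1) * (1 - k2)\<close> turns the limit into \<open>drift_mean\<close> times a positive
  multiple of a difference of values of \<open>F (b \<kappa>) / (1 - \<kappa>)\<close>, and that
  difference is positive by \<open>rate_factor_strict_mono\<close>.\<close>

lemma average_profit:
  assumes \<rho>: "\<rho> > 0" "\<rho> \<noteq> 1" and N: "N \<ge> 2" and rs: "r \<ge> 1" "s \<ge> 1"
  obtains L where "sgn L = sgn (1 - \<rho>)"
    and "\<And>x. (\<lambda>n. expected_profit \<rho> N r s x n / real n) \<longlonglongrightarrow> L"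
proof -
  obtain k1 k2 v1 v2 where k: "-1 < k2" "k2 < k1" "k1 < 0"
    and h: "\<And>c. drift \<rho> c = v1 c + v2 c"
    and eig: "\<And>c. game_B_step \<rho> v1 c = k1 * v1 c" "\<And>c. game_B_step \<rho> v2 c = k2 * v2 c"
    and m1: "\<And>c. v1 (c - 1) + v1 c + v1 (c + 1) = 3 * (drift_mean \<rho> * (1 - k2) / (k1 - k2))"
    and m2: "\<And>c. v2 (c - 1) + v2 c + v2 (c + 1) = 3 * (drift_mean \<rho> * (k1 - 1) / (k1 - k2))"
    by (rule drift_eigen_decomposition[OF \<rho>]) (rule that)
  note int = integrable_measure_pmf_finite[OF finite_set_capitals_after[OF N]]
  define a where "a = 1 - 3 / real N"
  define b where "b \<kappa> = 1 - (1 - \<kappa>) / real N" for \<kappa>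
  define F where "F t = (1 - a ^ r) * (1 - t ^ s) / ((1 - a ^ r * t ^ s) * (1 - t))" for t
  define L where "L = (drift_mean \<rho> * (1 - k2) / (k1 - k2) * F (b k1) +
      drift_mean \<rho> * (k1 - 1) / (k1 - k2) * F (b k2)) / real (r + s)"
  have ineq: "F (b k2) / (1 - k2) < F (b k1) / (1 - k1)"
  proof -
    have "\<bar>a\<bar> < 1"
      using N by (auto simp: a_def abs_less_iff divide_simps)
    then have a: "\<bar>a ^ r\<bar> < 1"
      using rs by (simp add: power_abs power_less_one_iff)
    have eq: "F (b \<kappa>) / (1 - \<kappa>) =
        (1 - a ^ r) / real N * ((1 - b \<kappa> ^ s) / ((1 - a ^ r * b \<kappa> ^ s) * (1 - b \<kappa>)\<^sup>2))" for \<kappa>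
    proof -
      \<comment> \<open>This supplies the second factor \<open>1 - b \<kappa>\<close> of the squared
        denominator in the rate function.\<close>
      have "1 - \<kappa> = real N * (1 - b \<kappa>)" using N by (simp add: b_def)
      then show ?thesis by (simp add: F_def power2_eq_square)
    qed
    show ?thesis
      unfolding eq
    proof (intro mult_strict_left_mono rate_factor_strict_mono)
      show "0 < (1 - a ^ r) / real N" using N a by simp
    qed (use N k a rs in \<open>auto simp: b_def divide_simps\<close>)
  qed
  have "L = drift_mean \<rho> * ((1 - k1) * (1 - k2) / (k1 - k2) *
      (F (b k1) / (1 - k1) - F (b k2) / (1 - k2)) / real (r + s))"
    using k by (simp add: L_def divide_simps) (simp add: algebra_simps)
  moreover have "0 < (1 - k1) * (1 - k2) / (k1 - k2) *
      (F (b k1) / (1 - k1) - F (b k2) / (1 - k2)) / real (r + s)"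
    using k ineq rs by (intro divide_pos_pos mult_pos_pos) auto
  moreover have "sgn (drift_mean \<rho>) = sgn (1 - \<rho>)"
  proof -
    have "0 < 3 * ((1 + \<rho>) * (1 + \<rho>\<^sup>2))"
      using \<rho> by (intro mult_pos_pos add_pos_nonneg) auto
    moreover have "sgn (t ^ 3) = sgn t" for t :: real
      by (auto simp: sgn_if zero_less_power_eq)
    ultimately show ?thesis
      by (simp only: drift_mean_def sgn_divide sgn_pos div_by_1)
  qed
  ultimately have "sgn L = sgn (1 - \<rho>)"
    by (simp only: sgn_mult sgn_pos mult_1_right)
  moreover have "(\<lambda>n. expected_profit \<rho> N r s x n / real n) \<longlonglongrightarrow> L" for x
  proof -
    define E where "E v i j = (if j mod (r + s) < r then 0 else
      measure_pmf.expectation (capitals_after \<rho> N r s x j) (\<lambda>y. v (y i)))"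
      for v :: "int \<Rightarrow> real" and i j
    \<comment> \<open>The limit depends neither on the player nor on the initial capitals, so
      averaging over the players preserves it.\<close>
    have "(\<lambda>n. (\<Sum>j<n. E v1 i j) / real n + (\<Sum>j<n. E v2 i j) / real n) \<longlonglongrightarrow> L" if i: "i < N" for i
      using tendsto_add[OF eigenfunction_average[OF \<rho>(1) N i rs m1 eig(1), of x]
          eigenfunction_average[OF \<rho>(1) N i rs m2 eig(2), of x]] k
      by (simp add: E_def L_def F_def a_def b_def add_divide_distrib)
    then have "(\<lambda>n. (\<Sum>i<N. (\<Sum>j<n. E v1 i j) / real n + (\<Sum>j<n. E v2 i j) / real n) / real N)
        \<longlonglongrightarrow> (\<Sum>i<N. L) / real N"
      using N by (intro tendsto_intros) auto
    moreover have "(\<Sum>i<N. (\<Sum>j<n. E v1 i j) / real n + (\<Sum>j<n. E v2 i j) / real n) / real N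
        = expected_profit \<rho> N r s x n / real n" for n
    proof -
      have "expected_profit \<rho> N r s x n = (\<Sum>j<n. \<Sum>i<N. (E v1 i j + E v2 i j) / real N)"
        unfolding expected_profit_eq_sum[OF \<rho>(1) N] E_def
        by (intro sum.cong) (auto simp: h int sum_divide_distrib)
      also have "\<dots> = (\<Sum>i<N. \<Sum>j<n. (E v1 i j + E v2 i j) / real N)"
        by (rule sum.swap)
      finally show ?thesis
        by (simp add: sum.distrib add_divide_distrib sum_divide_distrib mult.commute)
    qed
    ultimately show ?thesis using N by simp
  qed
  ultimately show ?thesis using that by blast
qed

text \<open>Uniqueness of limits makes the definite description denote \<open>L\<close>.\<close>

lemma mean_profit_eqI:
  assumes "\<And>x. (\<lambda>n. expected_profit \<rho> N r s x n / real n) \<longlonglongrightarrow> L"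
  shows "mean_profit \<rho> N r s = L"
  unfolding mean_profit_def using assms LIMSEQ_unique by blast

theorem theorem7:
  fixes \<rho> :: real and N r s :: nat
  assumes "\<rho> > 0" and "N \<ge> 2" and "r \<ge> 1" and "s \<ge> 1"
  shows "(\<forall>x. (\<lambda>n. expected_profit \<rho> N r s x n / real n) \<longlonglongrightarrow> mean_profit \<rho> N r s)
    \<and> (\<rho> < 1 \<longrightarrow> mean_profit \<rho> N r s > 0)
    \<and> (\<rho> = 1 \<longrightarrow> mean_profit \<rho> N r s = 0)
    \<and> (\<rho> > 1 \<longrightarrow> mean_profit \<rho> N r s < 0)"
proof -
  obtain L where L: "sgn L = sgn (1 - \<rho>)"
    and lim: "\<And>x. (\<lambda>n. expected_profit \<rho> N r s x n / real n) \<longlonglongrightarrow> L"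
  \<comment> \<open>At \<open>\<rho> = 1\<close> the two eigenvalues coincide and the decomposition
    breaks down, but there the drift itself is zero.\<close>
  proof (cases "\<rho> = 1")
    case True
    have "drift \<rho> c = 0" for c by (simp add: True drift_def win_prob_def)
    then have "expected_profit \<rho> N r s x n = 0" for x n
      unfolding expected_profit_eq_sum[OF assms(1,2)] by (intro sum.neutral) simp
    then show ?thesis using that[of 0] True by simp
  qed (use average_profit assms that in blast)
  have "mean_profit \<rho> N r s = L" using lim by (rule mean_profit_eqI)
  moreover have "L > 0 \<longleftrightarrow> \<rho> < 1" "L = 0 \<longleftrightarrow> \<rho> = 1" "L < 0 \<longleftrightarrow> \<rho> > 1"
    using L by (simp_all add: sgn_if split: if_splits)
  ultimately show ?thesis using lim by metis
qed

end
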